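(* Let $n \geq 1$ be an integer and let $\mathcal{E}$ be a set of binary classifiers $e : \mathbb{R} \to \{0,1\}$ that is closed under translation and satisfies $VCD(\mathcal{E}) = m$ over the instance space $\mathbb{R}$. Let $\mathcal{H}$ be the set of all top-expert mixture of experts binary classifiers on $\mathbb{R}$ with $n$ homogenous experts drawn from $\mathcal{E}$, i.e. the set of all functions $h : \mathbb{R} \to \{0,1\}$ for which there exist a partition $\{Z_1, \dots, Z_n\}$ of $\mathbb{R}$ and classifiers $e_1, \dots, e_n \in \mathcal{E}$ such that $h(x) = e_i(x)$ whenever $x \in Z_i$, for $i = 1, \dots, n$. Then $VCD(\mathcal{H}) \geq nm$ over the instance space $\mathbb{R}$.
   Context: Shattering: let $\mathcal{F}$ be a set of binary classifiers $f : \mathcal{X} \to \{0,1\}$ on an instance space $\mathcal{X}$. A finite set of points $X = \{x^{(1)}, \dots, x^{(k)}\} \subseteq \mathcal{X}$ is shattered by $\mathcal{F}$ if for any labels $y^{(1)}, \dots, y^{(k)} \in \{0,1\}$ there exists $f \in \mathcal{F}$ such that $f(x^{(i)}) = y^{(i)}$ for all $i = 1, \dots, k$. VC dimension: $VCD(\mathcal{F})$ is the cardinality of the largest finite subset of $\mathcal{X}$ that $\mathcal{F}$ shatters; if arbitrarily large finite subsets can be shattered, then $VCD(\mathcal{F}) := \infty$. Closed under translation: a set $\mathcal{F}$ of functions with domain $\mathbb{R}$ is closed under translation if for every $f \in \mathcal{F}$ and every $a \in \mathbb{R}$, the function $x \mapsto f(x + a)$ is also in $\mathcal{F}$. Top-expert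 mixture of experts: a model that assigns to each input exactly one of its $n$ experts via a (hard) partition $\{Z_1, \dots, Z_n\}$ of the instance space into $n$ cells, and outputs that expert's prediction; that is, a piecewise function equal to $e_i$ on $Z_i$. The cells of the partition may be arbitrary subsets of $\mathbb{R}$ that are pairwise disjoint and cover $\mathbb{R}$. The experts are homogenous in that they are all drawn from the same class $\mathcal{E}$ (they need not be distinct). *)

theory Defs
  imports Complex_Main "HOL-Library.Extended_Nat" "HOL-Library.Disjoint_Sets"
begin

text \<open>
  A binary classifier on the instance space \<open>'a\<close> is a function \<open>'a \<Rightarrow> bool\<close>, with
  \<open>False\<close> and \<open>True\<close> for the labels 0 and 1.  A labelling of the points of \<open>X\<close> is given
  by a function on the whole instance space of which only the values on \<open>X\<close> matter.
\<close>

definition shatters :: "('a \<Rightarrow> bool) set \<Rightarrow> 'a set \<Rightarrow> bool" where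
  "shatters F X \<longleftrightarrow> finite X \<and> (\<forall>y :: 'a \<Rightarrow> bool. \<exists>f\<in>F. \<forall>x\<in>X. f x = y x)"

text \<open>
  In \<^typ>\<open>enat\<close> the supremum of a nonempty set is its maximum if the set is finite and
  \<open>\<infinity>\<close> if it is unbounded.  The empty class shatters no set at all, not even
  the empty one, and gets VC dimension 0.
\<close>

definition VCD :: "('a \<Rightarrow> bool) set \<Rightarrow> enat" where
  "VCD F = (SUP X\<in>{X. shatters F X}. enat (card X))"

definition closed_under_translation :: "(real \<Rightarrow> 'b) set \<Rightarrow> bool" where
  "closed_under_translation F \<longleftrightarrow> (\<forall>f\<in>F. \<forall>a. (\<lambda>x. f (x + a)) \<in> F)"

text \<open>
  The cells \<open>Z 1, \<dots>, Z n\<close> are arbitrary (possibly empty) sets; the experts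
  \<open>e 1, \<dots>, e n\<close> need not be distinct.
\<close>

definition top_expert_moe :: "nat \<Rightarrow> ('a \<Rightarrow> bool) set \<Rightarrow> ('a \<Rightarrow> bool) set" where
  "top_expert_moe n E =
     {h. \<exists>(Z :: nat \<Rightarrow> 'a set) (e :: nat \<Rightarrow> 'a \<Rightarrow> bool).
           disjoint_family_on Z {1..n} \<and> (\<Union>i\<in>{1..n}. Z i) = UNIV \<and>
           (\<forall>i\<in>{1..n}. e i \<in> E \<and> (\<forall>x\<in>Z i. h x = e i x))}"

end

theory Submission
  imports Defs
begin

text \<open>
  If \<open>\<E>\<close> shatters \<open>X\<close>, then it shatters every translate of \<open>X\<close>. Choose \<open>n\<close> translates that are
  pairwise disjoint. A mixture that uses the translates as cells shatters their union, because
  each expert can realise the labelling of its own translate independently of the others.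
\<close>

lemma enat_le_VCD:
  assumes "shatters F X"
  shows "enat (card X) \<le> VCD F"
  unfolding VCD_def using assms by (intro SUP_upper) simp

text \<open>A value strictly below a supremum is exceeded by some member, whether
  \<open>VCD F\<close> is finite or infinite. For \<open>k = 0\<close> no such \<open>X\<close> need
  exist: the empty class has dimension 0 but shatters nothing.\<close>

lemma le_VCD_obtain:
  assumes "enat k \<le> VCD F" and "k > 0"
  obtains X where "shatters F X" and "k \<le> card X"
proof -
  obtain j where k: "k = Suc j"
    using \<open>k > 0\<close> gr0_implies_Suc by blast
  then have "enat j < VCD F"
    using assms(1) by (metis enat_ord_simps(2) lessI less_le_trans)
  then obtain X where "shatters F X" and "j < card X"
    unfolding VCD_def less_SUP_iff by auto
  then show thesis
    using that k by simp
qed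

text \<open>A labelling \<open>y\<close> of the translate pulls back to a labelling of
  \<open>X\<close>; a classifier realising the latter, shifted by \<open>- a\<close>, realises
  \<open>y\<close>.\<close>

lemma shatters_translate:
  assumes "closed_under_translation E" and "shatters E X"
  shows "shatters E ((\<lambda>x. x + a) ` X)"
  unfolding shatters_def
proof (intro conjI allI)
  show "finite ((\<lambda>x. x + a) ` X)"
    using assms(2) by (simp add: shatters_def)
next
  fix y :: "real \<Rightarrow> bool"
  obtain f where f: "f \<in> E" "\<forall>x\<in>X. f x = y (x + a)"
    using assms(2) unfolding shatters_def by (elim conjE allE[of _ "\<lambda>x. y (x + a)"]) blast
  moreover have "(\<lambda>x. f (x + - a)) \<in> E"
    using assms(1) f(1) unfolding closed_under_translation_def by blast
  ultimately show "\<exists>f\<in>E. \<forall>x\<in>(\<lambda>x. x + a) ` X. f x = y x"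
    by (intro bexI[of _ "\<lambda>x. f (x + - a)"]) auto
qed

lemma shatters_top_expert_moe_UN:
  assumes "n \<ge> 1" and disj: "disjoint_family_on X {1..n}"
    and sh: "\<And>i. i \<in> {1..n} \<Longrightarrow> shatters E (X i)"
  shows "shatters (top_expert_moe n E) (\<Union>i\<in>{1..n}. X i)"
  unfolding shatters_def
proof (intro conjI allI)
  show "finite (\<Union>i\<in>{1..n}. X i)"
    using sh by (simp add: shatters_def)
next
  fix y :: "'a \<Rightarrow> bool"
  have "\<forall>i\<in>{1..n}. \<exists>f\<in>E. \<forall>x\<in>X i. f x = y x"
    using sh unfolding shatters_def by blast
  then obtain e where e: "\<And>i. i \<in> {1..n} \<Longrightarrow> e i \<in> E"
      "\<And>i x. i \<in> {1..n} \<Longrightarrow> x \<in> X i \<Longrightarrow> e i x = y x"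
    by metis
  \<comment> \<open>The cells must cover the whole space, so the leftover points \<open>R\<close>
    join cell 1, which exists because \<open>n \<ge> 1\<close>.\<close>
  define R where "R = - (\<Union>i\<in>{1..n}. X i)"
  define Z where "Z i = (if i = 1 then X 1 \<union> R else X i)" for i
  \<comment> \<open>On \<open>R\<close> the labels \<open>y\<close> are unconstrained and may differ
    from \<open>e 1\<close>, so there \<open>h\<close> has to follow the expert instead.\<close>
  define h where "h x = (if x \<in> R then e 1 x else y x)" for x
  have XR: "X i \<inter> R = {}" if "i \<in> {1..n}" for i
    using that unfolding R_def by blast
  have "X i \<inter> X j = {}" if "i \<in> {1..n}" "j \<in> {1..n}" "i \<noteq> j" for i j
    using disj that unfolding disjoint_family_on_def by blast
  then have "disjoint_family_on Z {1..n}"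
    using XR \<open>n \<ge> 1\<close> unfolding disjoint_family_on_def Z_def
    by (simp add: Int_Un_distrib Int_Un_distrib2 Int_commute)
  moreover have "(\<Union>i\<in>{1..n}. Z i) = UNIV"
    using \<open>n \<ge> 1\<close> unfolding Z_def R_def by (auto split: if_splits)
  moreover have "\<forall>i\<in>{1..n}. e i \<in> E \<and> (\<forall>x\<in>Z i. h x = e i x)"
    using e XR unfolding Z_def h_def by (simp add: disjoint_iff) blast
  ultimately have "h \<in> top_expert_moe n E"
    unfolding top_expert_moe_def by blast
  moreover have "\<forall>x\<in>(\<Union>i\<in>{1..n}. X i). h x = y x"
    unfolding h_def R_def by auto
  ultimately show "\<exists>h\<in>top_expert_moe n E. \<forall>x\<in>(\<Union>i\<in>{1..n}. X i). h x = y x"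
    by blast
qed

lemma obtain_disjoint_translates:
  fixes X :: "real set"
  assumes "finite X"
  obtains c where "disjoint_family (\<lambda>i::nat. (\<lambda>x. x + real i * c) ` X)"
proof -
  \<comment> \<open>Inserting 0 keeps \<open>Max\<close> meaningful for empty \<open>X\<close> and
    yields \<open>B \<ge> 0\<close>.\<close>
  obtain B where B: "\<And>x. x \<in> X \<Longrightarrow> \<bar>x\<bar> \<le> B" and "B \<ge> 0"
    using assms that[of "Max (insert 0 (abs ` X))"] by simp
  \<comment> \<open>\<open>X\<close> has diameter at most \<open>2 * B\<close>; any larger shift
    separates the translates.\<close>
  define c where "c = 2 * B + 1"
  have "i = j" if "x \<in> X" "x' \<in> X" "x + real i * c = x' + real j * c" for i j x x'
  proof (rule ccontr)
    assume "i \<noteq> j"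
    \<comment> \<open>Distinct naturals differ by at least 1, so a common point would force
      \<open>c \<le> \<bar>x' - x\<bar> \<le> 2 * B\<close>.\<close>
    then have "1 * c \<le> \<bar>real i - real j\<bar> * c"
      using \<open>B \<ge> 0\<close> by (intro mult_right_mono) (auto simp: c_def)
    also have "\<dots> = \<bar>(real i - real j) * c\<bar>"
      using \<open>B \<ge> 0\<close> by (simp add: abs_mult c_def)
    also have "(real i - real j) * c = x' - x"
      using that(3) by (simp add: algebra_simps)
    finally show False
      using B[OF that(1)] B[OF that(2)] by (simp add: c_def)
  qed
  then have "disjoint_family (\<lambda>i::nat. (\<lambda>x. x + real i * c) ` X)"
    unfolding disjoint_family_on_def by blast
  then show thesis
    by (rule that)
qed

text \<open>Translation is injective, so \<open>n\<close> disjoint translates have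
  \<open>n * card X\<close> points in total. Working from a single shattered set serves finite and
  infinite \<open>VCD E\<close> alike.\<close>

lemma VCD_top_expert_moe_ge:
  assumes "n \<ge> 1" and "closed_under_translation E" and "shatters E X"
  shows "enat (n * card X) \<le> VCD (top_expert_moe n E)"
proof -
  have "finite X"
    using assms(3) by (simp add: shatters_def)
  then obtain c where c: "disjoint_family (\<lambda>i::nat. (\<lambda>x. x + real i * c) ` X)"
    by (rule obtain_disjoint_translates)
  let ?T = "\<lambda>i. (\<lambda>x. x + real i * c) ` X"
  have disj: "disjoint_family_on ?T {1..n}"
    using c unfolding disjoint_family_on_def by blast
  have "card (\<Union>i\<in>{1..n}. ?T i) = (\<Sum>i\<in>{1..n}. card (?T i))"
    using disj \<open>finite X\<close> unfolding disjoint_family_on_def by (intro card_UN_disjoint) auto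
  also have "\<dots> = n * card X"
    by (simp add: card_image)
  finally show ?thesis
    using enat_le_VCD[OF shatters_top_expert_moe_UN[OF assms(1) disj shatters_translate[OF assms(2,3)]]]
    by simp
qed

theorem proposition4p3:
  fixes n :: nat and m :: enat and E :: "(real \<Rightarrow> bool) set"
  assumes "n \<ge> 1"
    and "closed_under_translation E"
    and "VCD E = m"
  shows "VCD (top_expert_moe n E) \<ge> enat n * m"
proof -
  \<comment> \<open>If \<open>m\<close> is finite, \<open>k = m\<close> gives the claim; if
    \<open>m\<close> is infinite, \<open>k\<close> can be taken arbitrarily large.\<close>
  have *: "enat (n * k) \<le> VCD (top_expert_moe n E)" if k: "enat k \<le> m" for k
  proof (cases "k = 0")
    case False
    then obtain X where "shatters E X" and "k \<le> card X"
      using le_VCD_obtain k assms(3) by blast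
    then have "enat (n * k) \<le> enat (n * card X)"
      by simp
    also have "\<dots> \<le> VCD (top_expert_moe n E)"
      using assms(1,2) \<open>shatters E X\<close> by (rule VCD_top_expert_moe_ge)
    finally show ?thesis .
  qed (simp add: zero_enat_def[symmetric])
  show ?thesis
  proof (cases m)
    case (enat k)
    then show ?thesis
      using *[of k] by simp
  next
    case infinity
    \<comment> \<open>Since \<open>n \<ge> 1\<close>, the bounds \<open>n * k\<close> are unbounded
      in \<open>k\<close>, which forces the dimension to be \<open>\<infinity>\<close>.\<close>
    have "enat k \<le> VCD (top_expert_moe n E)" for k
    proof -
      have "enat k \<le> enat (n * k)"
        using \<open>n \<ge> 1\<close> by simp
      also have "\<dots> \<le> VCD (top_expert_moe n E)"
        using * infinity by simp
      finally show ?thesis .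
    qed
    then have "VCD (top_expert_moe n E) = \<infinity>"
      by (metis enat_ord_simps(1) not_enat_eq not_less_eq_eq order_refl)
    then show ?thesis
      by simp
  qed
qed

end
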